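(* For every real $x$ with $0<|x|<\frac{\pi}{2}$, $$2+\frac{17}{720}x^3\sin x<\frac{x}{\sin x}+\left[\frac{x/2}{\tan(x/2)}\right]^2<2+\frac{\pi^2+8\pi-32}{2\pi^3}x^3\sin x.$$ Moreover, the constants $\frac{17}{720}$ and $\frac{\pi^2+8\pi-32}{2\pi^3}$ are the best possible.
   Context: "Best possible" means that the constant in the lower bound cannot be replaced by any larger real constant, and the constant in the upper bound cannot be replaced by any smaller real constant, with the corresponding inequality still holding for all $x$ in the stated range. *)

theory Defs
  imports Complex_Main
begin

end

theory Submission
  imports Defs "HOL-Analysis.Gamma_Function" "HOL-Real_Asymp.Real_Asymp"
begin

text \<open>
  Write \<open>(x/2)\<^sup>2 / tan\<^sup>2 (x/2) = (x/2)\<^sup>2 / sin\<^sup>2 (x/2) - x\<^sup>2/4\<close> and put \<open>y = x\<^sup>2\<close>.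
  By Euler's product, \<open>x / sin x\<close> is the limit of products of factors \<open>1 / (1 - y / (\<pi>k)\<^sup>2)\<close>. Each factor
  has the form \<open>1 + p y + y\<^sup>2 r(y)\<close> with \<open>p \<ge> 0\<close> and \<open>r\<close> nonnegative and increasing, and this form is stable
  under products, under scaling of \<open>y\<close> and under limits. The linear coefficients of \<open>x / sin x\<close> and
  \<open>((x/2) / sin (x/2))\<^sup>2\<close> are \<open>1/6\<close> and \<open>1/12\<close> and cancel against \<open>x\<^sup>2/4\<close>, so the sum in question minus
  2, divided by \<open>x\<^sup>4\<close>, is increasing. Multiplying by the strictly increasing \<open>x / sin x\<close> shows that
  the quotient of the sum minus 2 by \<open>x\<^sup>3 sin x\<close> increases strictly, and both constants are
  its limits at \<open>0\<close> and \<open>\<pi>/2\<close>.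
\<close>

section \<open>Functions with a nonnegative increasing second-order remainder\<close>

text \<open>The linear coefficient \<open>p\<close> is a parameter because the later cancellation
  needs its exact value. Leaving out 0 lets the remainder be recovered by dividing by
  \<open>y\<^sup>2\<close>.\<close>

definition mono_remainder :: "real \<Rightarrow> real \<Rightarrow> (real \<Rightarrow> real) \<Rightarrow> bool"
  where "mono_remainder R p f \<longleftrightarrow> 0 \<le> p \<and>
    (\<exists>r. (\<forall>y\<in>{0<..<R}. f y = 1 + p * y + y\<^sup>2 * r y \<and> 0 \<le> r y) \<and> mono_on {0<..<R} r)"

lemma mono_remainder_const_1: "mono_remainder R 0 (\<lambda>_. 1)"
  unfolding mono_remainder_def by (intro conjI exI[of _ "\<lambda>_. 0"]) (auto simp: mono_on_def)

text \<open>The remainder of the product is a polynomial with nonnegative coefficients in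
  \<open>y\<close> and the two remainders, so it inherits sign and monotonicity.\<close>

lemma mono_remainder_mult:
  assumes "mono_remainder R p f" "mono_remainder R q g"
  shows "mono_remainder R (p + q) (\<lambda>y. f y * g y)"
proof -
  from assms obtain r s where
    p: "0 \<le> p" and q: "0 \<le> q" and
    r: "\<And>y. y \<in> {0<..<R} \<Longrightarrow> f y = 1 + p * y + y\<^sup>2 * r y"
       "\<And>y. y \<in> {0<..<R} \<Longrightarrow> 0 \<le> r y" "mono_on {0<..<R} r" and
    s: "\<And>y. y \<in> {0<..<R} \<Longrightarrow> g y = 1 + q * y + y\<^sup>2 * s y"
       "\<And>y. y \<in> {0<..<R} \<Longrightarrow> 0 \<le> s y" "mono_on {0<..<R} s"
    unfolding mono_remainder_def by metis
  define t where "t y = p * q + r y + s y + y * (p * s y + q * r y) + y\<^sup>2 * (r y * s y)" for y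
  have "f y * g y = 1 + (p + q) * y + y\<^sup>2 * t y" if "y \<in> {0<..<R}" for y
    unfolding r(1)[OF that] s(1)[OF that] t_def by algebra
  moreover have "0 \<le> t y" if "y \<in> {0<..<R}" for y
    using r(2)[OF that] s(2)[OF that] p q that unfolding t_def by simp
  moreover have "mono_on {0<..<R} t"
  proof (rule mono_onI)
    fix x y assume xy: "x \<in> {0<..<R}" "y \<in> {0<..<R}" "x \<le> y"
    have "r x \<le> r y" "s x \<le> s y"
      using mono_onD[OF r(3) xy] mono_onD[OF s(3) xy] by auto
    with xy r(2) s(2) p q show "t x \<le> t y"
      unfolding t_def by (intro add_mono mult_mono power_mono order_refl) auto
  qed
  ultimately show ?thesis
    unfolding mono_remainder_def using p q by (metis add_nonneg_nonneg)
qed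

lemma mono_remainder_prod:
  assumes "finite A" "\<And>k. k \<in> A \<Longrightarrow> mono_remainder R (p k) (f k)"
  shows "mono_remainder R (\<Sum>k\<in>A. p k) (\<lambda>y. \<Prod>k\<in>A. f k y)"
  using assms
  by (induction A rule: finite_induct) (simp_all add: mono_remainder_const_1 mono_remainder_mult)

lemma mono_remainder_geometric:
  assumes "0 < a" "R \<le> a"
  shows "mono_remainder R (1 / a) (\<lambda>y. 1 / (1 - y / a))"
proof -
  \<comment> \<open>The tail of the geometric series from the quadratic term on, divided by
    \<open>y\<^sup>2\<close>.\<close>
  define r where "r y = 1 / (a * (a - y))" for y
  have "1 / (1 - y / a) = 1 + 1 / a * y + y\<^sup>2 * r y" if "y \<in> {0<..<R}" for y
    using assms that unfolding r_def by (simp add: divide_simps) algebra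
  moreover have "0 \<le> r y" if "y \<in> {0<..<R}" for y
    using assms that by (simp add: r_def)
  moreover have "mono_on {0<..<R} r"
    unfolding r_def using assms by (intro mono_onI divide_left_mono mult_left_mono mult_pos_pos) auto
  ultimately show ?thesis
    unfolding mono_remainder_def using assms by (metis zero_le_divide_1_iff less_imp_le)
qed

text \<open>Needed with \<open>c = 1 / 4\<close>, which replaces \<open>x\<close> by
  \<open>x / 2\<close> when \<open>y = x\<^sup>2\<close>. The bound \<open>c \<le> 1\<close> keeps
  \<open>c * y\<close> inside the interval.\<close>

lemma mono_remainder_scale:
  assumes "mono_remainder R p f" and c: "0 < c" and "c \<le> 1"
  shows "mono_remainder R (c * p) (\<lambda>y. f (c * y))"
proof -
  from assms obtain r where
    p: "0 \<le> p" and
    r: "\<And>y. y \<in> {0<..<R} \<Longrightarrow> f y = 1 + p * y + y\<^sup>2 * r y"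
       "\<And>y. y \<in> {0<..<R} \<Longrightarrow> 0 \<le> r y" "mono_on {0<..<R} r"
    unfolding mono_remainder_def by metis
  have cy: "c * y \<in> {0<..<R}" if "y \<in> {0<..<R}" for y
    using that c \<open>c \<le> 1\<close> by (auto intro: le_less_trans[OF mult_left_le_one_le])
  define s where "s y = c\<^sup>2 * r (c * y)" for y
  have "f (c * y) = 1 + c * p * y + y\<^sup>2 * s y" if "y \<in> {0<..<R}" for y
    unfolding r(1)[OF cy[OF that]] s_def by algebra
  moreover have "0 \<le> s y" if "y \<in> {0<..<R}" for y
    using r(2)[OF cy[OF that]] by (simp add: s_def)
  moreover have "mono_on {0<..<R} s"
    unfolding s_def using c cy by (intro mono_onI mult_left_mono mono_onD[OF r(3)]) auto
  ultimately show ?thesis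
    unfolding mono_remainder_def using p c by (metis mult_nonneg_nonneg less_imp_le)
qed

text \<open>Pointwise convergence suffices: the remainders converge pointwise as well, and
  nonnegativity and monotonicity are preserved by pointwise limits.\<close>

lemma mono_remainder_lim:
  assumes f: "\<And>n. mono_remainder R (p n) (f n)"
    and p: "p \<longlonglongrightarrow> q" and g: "\<And>y. y \<in> {0<..<R} \<Longrightarrow> (\<lambda>n. f n y) \<longlonglongrightarrow> g y"
  shows "mono_remainder R q g"
proof -
  from f obtain r where
    p0: "\<And>n. 0 \<le> p n" and
    r: "\<And>n y. y \<in> {0<..<R} \<Longrightarrow> f n y = 1 + p n * y + y\<^sup>2 * r n y"
       "\<And>n y. y \<in> {0<..<R} \<Longrightarrow> 0 \<le> r n y" "\<And>n. mono_on {0<..<R} (r n)"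
    unfolding mono_remainder_def by metis
  define s where "s y = (g y - 1 - q * y) / y\<^sup>2" for y
  have lim: "(\<lambda>n. r n y) \<longlonglongrightarrow> s y" if y: "y \<in> {0<..<R}" for y
  proof -
    have "(\<lambda>n. (f n y - 1 - p n * y) / y\<^sup>2) \<longlonglongrightarrow> s y"
      unfolding s_def using y by (intro tendsto_intros p g) auto
    also have "(\<lambda>n. (f n y - 1 - p n * y) / y\<^sup>2) = (\<lambda>n. r n y)"
      using y by (simp add: r(1))
    finally show ?thesis .
  qed
  have "0 \<le> s y" if "y \<in> {0<..<R}" for y
    using LIMSEQ_le_const[OF lim] r(2) that by blast
  moreover have "mono_on {0<..<R} s"
    by (intro mono_onI LIMSEQ_le[OF lim lim]) (use mono_onD[OF r(3)] in auto)
  moreover have "g y = 1 + q * y + y\<^sup>2 * s y" if "y \<in> {0<..<R}" for y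
    using that by (simp add: s_def)
  moreover have "0 \<le> q"
    using LIMSEQ_le_const[OF p] p0 by blast
  ultimately show ?thesis
    unfolding mono_remainder_def by blast
qed

section \<open>Euler's product and the expansion of \<open>x / sin x\<close>\<close>

lemma mono_remainder_x_over_sin:
  "mono_remainder (pi\<^sup>2) (1 / 6) (\<lambda>y. sqrt y / sin (sqrt y))"
proof (rule mono_remainder_lim)
  fix n :: nat
  \<comment> \<open>The pole of factor \<open>k\<close> lies at
    \<open>(pi * real k)\<^sup>2\<close>, hence not before \<open>pi\<^sup>2\<close>.\<close>
  show "mono_remainder (pi\<^sup>2) (\<Sum>k\<in>{1..n}. 1 / (pi * real k)\<^sup>2)
          (\<lambda>y. \<Prod>k\<in>{1..n}. 1 / (1 - y / (pi * real k)\<^sup>2))"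
    by (intro mono_remainder_prod mono_remainder_geometric)
       (auto simp: power_mult_distrib intro: mult_le_cancel_left1[THEN iffD2])
next
  \<comment> \<open>The Basel sum gives the linear coefficient.\<close>
  have "(\<lambda>n. (\<Sum>k<n. 1 / (real k + 1)\<^sup>2) / pi\<^sup>2) \<longlonglongrightarrow> (pi\<^sup>2 / 6) / pi\<^sup>2"
    using inverse_squares_sums unfolding sums_def by (intro tendsto_intros) (simp_all add: add_ac)
  moreover have "(\<Sum>k\<in>{1..n}. 1 / (pi * real k)\<^sup>2) = (\<Sum>k<n. 1 / (real k + 1)\<^sup>2) / pi\<^sup>2" for n
    unfolding sum_divide_distrib
    by (rule sum.reindex_bij_witness[of _ Suc "\<lambda>k. k - 1"]) (auto simp: power_mult_distrib add_ac)
  ultimately show "(\<lambda>n. \<Sum>k\<in>{1..n}. 1 / (pi * real k)\<^sup>2) \<longlonglongrightarrow> 1 / 6"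
    by simp
next
  fix y :: real assume y: "y \<in> {0<..<pi\<^sup>2}"
  define x where "x = sqrt y"
  have x: "0 < x" "x < pi" and y_eq: "y = x\<^sup>2"
    using y real_sqrt_less_mono[of y "pi\<^sup>2"] by (auto simp: x_def)
  have "sin x \<noteq> 0" using sin_gt_zero[of x] x by simp
  have "(\<lambda>n. x / (pi * (x / pi) * (\<Prod>k=1..n. 1 - (x / pi)\<^sup>2 / (real k)\<^sup>2)))
          \<longlonglongrightarrow> x / sin (pi * (x / pi))"
    using \<open>sin x \<noteq> 0\<close> by (intro tendsto_intros sin_product_formula_real) auto
  moreover have "x / (pi * (x / pi) * (\<Prod>k=1..n. 1 - (x / pi)\<^sup>2 / (real k)\<^sup>2)) =
      (\<Prod>k\<in>{1..n}. 1 / (1 - y / (pi * real k)\<^sup>2))" for n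
    using x by (simp add: y_eq prod_dividef power_divide power_mult_distrib)
  ultimately show "(\<lambda>n. \<Prod>k\<in>{1..n}. 1 / (1 - y / (pi * real k)\<^sup>2)) \<longlonglongrightarrow> sqrt y / sin (sqrt y)"
    by (simp add: x_def)
qed

lemma half_cot_squared:
  assumes "sin (x / 2 :: real) \<noteq> 0"
  shows "((x / 2) / tan (x / 2))\<^sup>2 = ((x / 2) / sin (x / 2))\<^sup>2 - x\<^sup>2 / 4"
proof -
  have "(cos (x / 2))\<^sup>2 = 1 - (sin (x / 2))\<^sup>2"
    by (simp add: cos_squared_eq)
  with assms show ?thesis
    by (simp add: tan_def power_divide power_mult_distrib diff_divide_distrib right_diff_distrib)
qed

section \<open>Monotonicity of the quotients\<close>

definition wilker_sum :: "real \<Rightarrow> real"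
  where "wilker_sum x = x / sin x + ((x / 2) / tan (x / 2))\<^sup>2"

text \<open>The value of \<open>c\<close> for which \<open>2 + c * x ^ 3 * sin x\<close> equals the
  sum, so the best constants are the infimum and the supremum of this quotient.\<close>

definition wilker_ratio :: "real \<Rightarrow> real"
  where "wilker_ratio x = (wilker_sum x - 2) / (x ^ 3 * sin x)"

text \<open>Strictness comes from the linear term, since the remainder is only weakly
  increasing.\<close>

lemma x_over_sin_strict_mono: "strict_mono_on {0<..<pi} (\<lambda>x. x / sin x)"
proof (rule strict_mono_onI)
  fix x y :: real assume xy: "x \<in> {0<..<pi}" "y \<in> {0<..<pi}" "x < y"
  obtain r where
    r: "\<And>y. y \<in> {0<..<pi\<^sup>2} \<Longrightarrow> sqrt y / sin (sqrt y) = 1 + 1 / 6 * y + y\<^sup>2 * r y"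
       "\<And>y. y \<in> {0<..<pi\<^sup>2} \<Longrightarrow> 0 \<le> r y" "mono_on {0<..<pi\<^sup>2} r"
    using mono_remainder_x_over_sin unfolding mono_remainder_def by metis
  have sq: "x\<^sup>2 \<in> {0<..<pi\<^sup>2}" "y\<^sup>2 \<in> {0<..<pi\<^sup>2}" "x\<^sup>2 < y\<^sup>2"
    using xy by (auto intro: power_strict_mono)
  have "(x\<^sup>2)\<^sup>2 * r (x\<^sup>2) \<le> (y\<^sup>2)\<^sup>2 * r (y\<^sup>2)"
    using sq(3) r(2)[OF sq(1)] mono_onD[OF r(3) sq(1,2)]
    by (intro mult_mono power_mono[of "x\<^sup>2"]) simp_all
  with r(1)[OF sq(1)] r(1)[OF sq(2)] sq(3) xy show "x / sin x < y / sin y"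
    by simp
qed

lemma wilker_quartic_mono: "mono_on {0<..<pi} (\<lambda>x. (wilker_sum x - 2) / x ^ 4)"
proof (rule mono_onI)
  fix x y :: real assume xy: "x \<in> {0<..<pi}" "y \<in> {0<..<pi}" "x \<le> y"
  obtain r where
    r: "\<And>y. y \<in> {0<..<pi\<^sup>2} \<Longrightarrow> sqrt y / sin (sqrt y) = 1 + 1 / 6 * y + y\<^sup>2 * r y"
       "mono_on {0<..<pi\<^sup>2} r"
    using mono_remainder_x_over_sin unfolding mono_remainder_def by metis
  have "mono_remainder (pi\<^sup>2) (1 / 4 * (1 / 6) + 1 / 4 * (1 / 6))
          (\<lambda>y. sqrt (1 / 4 * y) / sin (sqrt (1 / 4 * y)) * (sqrt (1 / 4 * y) / sin (sqrt (1 / 4 * y))))"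
    by (intro mono_remainder_mult mono_remainder_scale[OF mono_remainder_x_over_sin]) auto
  then obtain s where
    s: "\<And>y. y \<in> {0<..<pi\<^sup>2} \<Longrightarrow> (sqrt (1 / 4 * y) / sin (sqrt (1 / 4 * y)))\<^sup>2 = 1 + 1 / 12 * y + y\<^sup>2 * s y"
       "mono_on {0<..<pi\<^sup>2} s"
    unfolding mono_remainder_def power2_eq_square by auto
  have eq: "(wilker_sum z - 2) / z ^ 4 = r (z\<^sup>2) + s (z\<^sup>2)" and z2: "z\<^sup>2 \<in> {0<..<pi\<^sup>2}"
    if z: "z \<in> {0<..<pi}" for z
  proof -
    show z2: "z\<^sup>2 \<in> {0<..<pi\<^sup>2}"
      using z by (auto intro: power_strict_mono)
    have "sin (z / 2) > 0"
      using z by (intro sin_gt_zero) auto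
    moreover have "sqrt (1 / 4 * z\<^sup>2) = z / 2"
      using z by (intro real_sqrt_unique) (auto simp: power_divide)
    moreover have "sqrt (z\<^sup>2) = z"
      using z by simp
    \<comment> \<open>The constant terms add up to 2 and \<open>1 / 6 + 1 / 12 = 1 / 4\<close>
      cancels against \<open>z\<^sup>2 / 4\<close>, so only the two remainders survive.\<close>
    ultimately have "wilker_sum z - 2 = (z\<^sup>2)\<^sup>2 * (r (z\<^sup>2) + s (z\<^sup>2))"
      using r(1)[OF z2] s(1)[OF z2] half_cot_squared[of z] unfolding wilker_sum_def
      by (simp only: distrib_left)
    then show "(wilker_sum z - 2) / z ^ 4 = r (z\<^sup>2) + s (z\<^sup>2)"
      using z by simp
  qed
  show "(wilker_sum x - 2) / x ^ 4 \<le> (wilker_sum y - 2) / y ^ 4"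
    unfolding eq[OF xy(1)] eq[OF xy(2)] using xy z2
    by (intro add_mono mono_onD[OF r(2)] mono_onD[OF s(2)] power_mono) auto
qed

text \<open>The fourth-order Taylor coefficients are 7/360 for \<open>x / sin x\<close> and 1/240
  for the square of \<open>(x / 2) / sin (x / 2)\<close>; their sum is 17/720.\<close>

lemma wilker_quartic_at_0: "((\<lambda>x. (wilker_sum x - 2) / x ^ 4) \<longlongrightarrow> 17 / 720) (at_right 0)"
  unfolding wilker_sum_def by real_asymp

lemma wilker_ratio_at_0: "(wilker_ratio \<longlongrightarrow> 17 / 720) (at_right 0)"
  unfolding wilker_ratio_def wilker_sum_def by real_asymp

lemma wilker_ratio_pi_half: "wilker_ratio (pi / 2) = (pi ^ 2 + 8 * pi - 32) / (2 * pi ^ 3)"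
  by (simp add: wilker_ratio_def wilker_sum_def tan_45 power_divide field_simps eval_nat_numeral)

text \<open>An increasing function stays above its right limit at 0. This also supplies the
  positivity needed when multiplying by \<open>x / sin x\<close>.\<close>

lemma wilker_quartic_ge:
  assumes "x \<in> {0<..<pi}"
  shows "17 / 720 \<le> (wilker_sum x - 2) / x ^ 4"
proof (rule tendsto_upperbound[OF wilker_quartic_at_0])
  show "\<forall>\<^sub>F t in at_right 0. (wilker_sum t - 2) / t ^ 4 \<le> (wilker_sum x - 2) / x ^ 4"
    using eventually_at_right_less[of 0] eventually_at_right_real[of 0 x] assms
    by (auto elim!: eventually_mono intro!: mono_onD[OF wilker_quartic_mono])
qed simp

lemma wilker_ratio_eq: "wilker_ratio x = (wilker_sum x - 2) / x ^ 4 * (x / sin x)"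
  by (simp add: wilker_ratio_def eval_nat_numeral)

lemma wilker_ratio_strict_mono: "strict_mono_on {0<..<pi} wilker_ratio"
proof (rule strict_mono_onI)
  fix x y :: real assume xy: "x \<in> {0<..<pi}" "y \<in> {0<..<pi}" "x < y"
  show "wilker_ratio x < wilker_ratio y"
    unfolding wilker_ratio_eq
  proof (rule mult_le_less_imp_less)
    show "(wilker_sum x - 2) / x ^ 4 \<le> (wilker_sum y - 2) / y ^ 4"
      using xy by (intro mono_onD[OF wilker_quartic_mono]) auto
    show "x / sin x < y / sin y"
      using xy by (intro strict_mono_onD[OF x_over_sin_strict_mono]) auto
    show "0 < (wilker_sum x - 2) / x ^ 4"
      using wilker_quartic_ge[OF xy(1)] by linarith
    show "0 \<le> x / sin x"
      using xy sin_gt_zero[of x] by auto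
  qed
qed

text \<open>The bound on the quartic quotient is weak; the factor \<open>x / sin x > 1\<close> makes
  it strict.\<close>

lemma wilker_ratio_gt:
  assumes "x \<in> {0<..<pi}"
  shows "17 / 720 < wilker_ratio x"
proof -
  \<comment> \<open>The weak bound at \<open>x / 2\<close> becomes strict at \<open>x\<close> by
    strict monotonicity.\<close>
  have "1 \<le> (x / 2) / sin (x / 2)"
    using assms sin_gt_zero[of "x / 2"] sin_x_le_x[of "x / 2"] by simp
  also have "\<dots> < x / sin x"
    using assms by (intro strict_mono_onD[OF x_over_sin_strict_mono]) auto
  finally have "17 / 720 < 17 / 720 * (x / sin x)"
    by simp
  also have "\<dots> \<le> wilker_ratio x"
    unfolding wilker_ratio_eq using assms sin_gt_zero[of x] wilker_quartic_ge[OF assms]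
    by (intro mult_right_mono) auto
  finally show ?thesis .
qed

section \<open>Evenness and the sharp constants\<close>

lemma wilker_ratio_abs: "wilker_ratio \<bar>x\<bar> = wilker_ratio x"
  by (simp add: wilker_ratio_def wilker_sum_def abs_if)

lemma cube_mult_sin_pos:
  assumes "0 < \<bar>x\<bar>" "\<bar>x\<bar> < pi"
  shows "0 < x ^ 3 * sin x"
  using assms sin_gt_zero[of "\<bar>x\<bar>"]
  by (auto simp: abs_if zero_less_mult_iff split: if_splits)

text \<open>Division by the positive \<open>x ^ 3 * sin x\<close>; evenness of the quotient covers
  negative \<open>x\<close>.\<close>

lemma wilker_bound_iff:
  assumes "0 < \<bar>x\<bar>" "\<bar>x\<bar> < pi"
  shows "2 + c * x ^ 3 * sin x < x / sin x + ((x / 2) / tan (x / 2)) ^ 2 \<longleftrightarrow> c < wilker_ratio \<bar>x\<bar>"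
    and "x / sin x + ((x / 2) / tan (x / 2)) ^ 2 < 2 + c * x ^ 3 * sin x \<longleftrightarrow> wilker_ratio \<bar>x\<bar> < c"
  using cube_mult_sin_pos[OF assms]
  unfolding wilker_ratio_abs unfolding wilker_ratio_def wilker_sum_def
  by (auto simp: less_divide_eq divide_less_eq mult.assoc algebra_simps)

theorem theorem3p2:
  shows "(\<forall>x::real. 0 < \<bar>x\<bar> \<and> \<bar>x\<bar> < pi / 2 \<longrightarrow>
            2 + 17 / 720 * x ^ 3 * sin x < x / sin x + ((x / 2) / tan (x / 2)) ^ 2 \<and>
            x / sin x + ((x / 2) / tan (x / 2)) ^ 2
              < 2 + (pi ^ 2 + 8 * pi - 32) / (2 * pi ^ 3) * x ^ 3 * sin x)
       \<and> (\<forall>c::real. c > 17 / 720 \<longrightarrow>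
            \<not> (\<forall>x::real. 0 < \<bar>x\<bar> \<and> \<bar>x\<bar> < pi / 2 \<longrightarrow>
                  2 + c * x ^ 3 * sin x < x / sin x + ((x / 2) / tan (x / 2)) ^ 2))
       \<and> (\<forall>c::real. c < (pi ^ 2 + 8 * pi - 32) / (2 * pi ^ 3) \<longrightarrow>
            \<not> (\<forall>x::real. 0 < \<bar>x\<bar> \<and> \<bar>x\<bar> < pi / 2 \<longrightarrow>
                  x / sin x + ((x / 2) / tan (x / 2)) ^ 2 < 2 + c * x ^ 3 * sin x))"
proof (intro conjI allI impI notI)
  fix x :: real assume x: "0 < \<bar>x\<bar> \<and> \<bar>x\<bar> < pi / 2"
  then have x': "0 < \<bar>x\<bar>" "\<bar>x\<bar> < pi"
    by auto
  show "2 + 17 / 720 * x ^ 3 * sin x < x / sin x + ((x / 2) / tan (x / 2)) ^ 2"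
    using wilker_ratio_gt x' by (simp only: wilker_bound_iff) simp
  have "wilker_ratio \<bar>x\<bar> < wilker_ratio (pi / 2)"
    using x by (intro strict_mono_onD[OF wilker_ratio_strict_mono]) auto
  then show "x / sin x + ((x / 2) / tan (x / 2)) ^ 2
      < 2 + (pi ^ 2 + 8 * pi - 32) / (2 * pi ^ 3) * x ^ 3 * sin x"
    unfolding wilker_bound_iff(2)[OF x'] wilker_ratio_pi_half .
next
  fix c :: real
  assume c: "c > 17 / 720" and
    all: "\<forall>x::real. 0 < \<bar>x\<bar> \<and> \<bar>x\<bar> < pi / 2 \<longrightarrow>
            2 + c * x ^ 3 * sin x < x / sin x + ((x / 2) / tan (x / 2)) ^ 2"
  have less: "c < wilker_ratio x" if "x \<in> {0<..<pi / 2}" for x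
    using wilker_bound_iff(1)[of x c] all that by auto
  have "\<forall>\<^sub>F x in at_right 0. c \<le> wilker_ratio x"
    using eventually_at_right_real[of 0 "pi / 2"]
    by (auto elim!: eventually_mono intro!: less_imp_le[OF less])
  then have "c \<le> 17 / 720"
    by (intro tendsto_lowerbound[OF wilker_ratio_at_0]) auto
  with c show False by simp
next
  fix c :: real
  assume c: "c < (pi ^ 2 + 8 * pi - 32) / (2 * pi ^ 3)" and
    all: "\<forall>x::real. 0 < \<bar>x\<bar> \<and> \<bar>x\<bar> < pi / 2 \<longrightarrow>
            x / sin x + ((x / 2) / tan (x / 2)) ^ 2 < 2 + c * x ^ 3 * sin x"
  have less: "wilker_ratio x < c" if "x \<in> {0<..<pi / 2}" for x
    using wilker_bound_iff(2)[of x c] all that by auto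
  \<comment> \<open>The endpoint lies outside the range of \<open>x\<close>, so continuity has to
    carry the bound over to it.\<close>
  have "isCont wilker_ratio (pi / 2)"
    unfolding wilker_ratio_def wilker_sum_def
    by (intro continuous_intros) (auto simp: tan_45 cos_45)
  then have "(wilker_ratio \<longlongrightarrow> wilker_ratio (pi / 2)) (at_left (pi / 2))"
    by (auto simp: isCont_def intro: filterlim_mono at_le)
  moreover have "\<forall>\<^sub>F x in at_left (pi / 2). wilker_ratio x \<le> c"
    using eventually_at_left_real[of 0 "pi / 2"]
    by (auto elim!: eventually_mono intro!: less_imp_le[OF less])
  ultimately have "wilker_ratio (pi / 2) \<le> c"
    by (intro tendsto_upperbound) auto
  with c show False
    unfolding wilker_ratio_pi_half by simp
qed

end
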